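(* In the setting described in the context, let $\gamma\in(0,2\theta)$ and fix any $\delta\in(0,1)$. Then, with probability at least $1-\delta$ over the random draw $\mathcal D\sim\mathbb P^N$, $$\rho_{\mathrm{DY}}(\hat z_K)\le\hat\rho_{\mathcal D}(\hat z_K)+\gamma\big(\hat\ell_{\mathcal D}(\omega_K)+\kappa(N,K,\delta)\big),$$ where $\hat\ell_{\mathcal D}(\omega_K)=\frac1N\sum_{i=1}^N\ell_\Delta(\omega_K,\xi^i)=\frac1N\sum_{i=1}^N\|\hat\zeta_K-O(\hat x_K,\xi^i)\|$ and $$\kappa(N,K,\delta)=2\beta_K+(4N\beta_K+\varsigma)\sqrt{\frac{\log(1/\delta)}{2N}},\qquad \beta_K=\frac{2\eta_K}{\theta}+\frac{\varsigma}{N}.$$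
   Context: Let $n,d,N\in\mathbb N$ with $N\ge1$, $K\in\mathbb N$, $\gamma>0$, $\theta>0$, $\varsigma>0$; $\mathbb R^n$ carries the Euclidean inner product and norm. $A,B:\mathbb R^n\rightrightarrows\mathbb R^n$ are maximally monotone set-valued operators and $C:\mathbb R^n\to\mathbb R^n$ is $\theta$-cocoercive, where a map $F:\mathbb R^n\to\mathbb R^n$ is $\theta$-cocoercive if $\langle x-y,F(x)-F(y)\rangle\ge\theta\|F(x)-F(y)\|^2$ for all $x,y$. It is assumed that $\operatorname{zer}(A+B+C)=\{x:0\in A(x)+B(x)+C(x)\}\neq\emptyset$. The resolvent of a maximally monotone $A$ is $J_{\gamma A}=(\mathrm{Id}+\gamma A)^{-1}$ (single-valued, defined on all of $\mathbb R^n$). Oracle: $\Xi\subseteq\mathbb R^d$ is a sample space with a probability distribution $\mathbb P$, and $O:\mathbb R^n\times\Xi\to\mathbb R^n$ (measurable in $\xi$) satisfies: (i) $\mathbb E_{\xi\sim\mathbb P}[O(x,\xi)]=C(x)$ for all $x$; (ii) $\|O(x,\xi)-O(x,\xi')\|\le\varsigma$ for all $x\in\mathbb R^n$, $\xi,\xi'\in\Xi$; (iii) $O(\cdot,\xi)$ is $\theta$-cocoercive for every $\xi\in\Xi$. A dataset is $\mathcal D=(\xi^1,\dots,\xi^N)\in\Xi^N$; $\mathcal D\sim\mathbb P^N$ means the samples are i.i.d. from $\mathbb P$. Put $\widehat C_{\mathcal D}(x)=\frac1N\sum_{i=1}^N O(x,\xi^i)$. From a fixed (deterministic, dataset-independent)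 initial point $\hat z_0\in\mathbb R^n$, the data-driven Davis–Yin iteration is $\hat x_t=J_{\gamma B}(\hat z_t)$, $\hat y_t=J_{\gamma A}(2\hat x_t-\hat z_t-\gamma\widehat C_{\mathcal D}(\hat x_t))$, $\hat z_{t+1}=\hat z_t+\hat y_t-\hat x_t$. The output (hypothesis) after $K$ steps is $\omega_K=\mathcal A_{\mathrm{DY}}(\mathcal D)=(\hat x_K,\hat y_K,\hat z_K,\hat\zeta_K)$ with $\hat\zeta_K=\widehat C_{\mathcal D}(\hat x_K)$. For $\omega=(x,y,z,\zeta)$ and $\xi\in\Xi$, the loss is $\ell_\Delta(\omega,\xi)=\|\zeta-O(x,\xi)\|$. Define $T_{\mathrm{DY}}(z)=z-J_{\gamma B}(z)+J_{\gamma A}\big(2J_{\gamma B}(z)-z-\gamma C(J_{\gamma B}(z))\big)$, and $\widehat T_{\mathcal D}$ by the same formula with $\widehat C_{\mathcal D}$ in place of $C$ (so $\hat z_{t+1}=\widehat T_{\mathcal D}(\hat z_t)$). Residuals: $\rho_{\mathrm{DY}}(z)=\|z-T_{\mathrm{DY}}(z)\|$, $\hat\rho_{\mathcal D}(z)=\|z-\widehat T_{\mathcal D}(z)\|$. For $i\in\{1,\dots,N\}$, $\mathcal D^i$ denotes a dataset obtained from $\mathcal D$ by replacing its $i$-th sample with an arbitrary $\tilde\xi^i\in\Xi$, and $\hat x_K^i$ is the corresponding iterate for $\mathcal D^i$ from the same initial point $\hat z_0$. The replace-one sensitivity is $\eta_K=\max_{i}\sup_{\mathcal D,\mathcal D^i}\|\hat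 x_K-\hat x_K^i\|$. *)

theory Defs
  imports "HOL-Probability.Probability"
begin

definition monotone_operator :: "('a::real_inner \<Rightarrow> 'a set) \<Rightarrow> bool" where
  "monotone_operator A \<longleftrightarrow> (\<forall>x y. \<forall>u\<in>A x. \<forall>v\<in>A y. (x - y) \<bullet> (u - v) \<ge> 0)"

definition maximally_monotone :: "('a::real_inner \<Rightarrow> 'a set) \<Rightarrow> bool" where
  "maximally_monotone A \<longleftrightarrow> monotone_operator A \<and>
     (\<forall>A'. monotone_operator A' \<and> (\<forall>x. A x \<subseteq> A' x) \<longrightarrow> A' = A)"

text \<open>The point \<open>x\<close> with \<open>z \<in> (Id + \<gamma> A) x\<close>. In a complete space, for maximally
  monotone \<open>A\<close> and \<open>\<gamma> > 0\<close>, it exists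
  (Minty's theorem) and is unique, for every \<open>z\<close>, so the description is proper.\<close>

definition resolvent :: "real \<Rightarrow> ('a::real_inner \<Rightarrow> 'a set) \<Rightarrow> 'a \<Rightarrow> 'a" where
  "resolvent \<gamma> A z = (THE x. z \<in> {x + \<gamma> *\<^sub>R u | u. u \<in> A x})"

definition cocoercive :: "real \<Rightarrow> ('a::real_inner \<Rightarrow> 'a) \<Rightarrow> bool" where
  "cocoercive \<theta> F \<longleftrightarrow> (\<forall>x y. (x - y) \<bullet> (F x - F y) \<ge> \<theta> * (norm (F x - F y))\<^sup>2)"

definition zer_sum :: "('a::real_inner \<Rightarrow> 'a set) \<Rightarrow> ('a \<Rightarrow> 'a set) \<Rightarrow> ('a \<Rightarrow> 'a) \<Rightarrow> 'a set" where
  "zer_sum A B C = {x. 0 \<in> {a + b + C x | a b. a \<in> A x \<and> b \<in> B x}}"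

definition dy_operator ::
  "real \<Rightarrow> ('a::real_inner \<Rightarrow> 'a set) \<Rightarrow> ('a \<Rightarrow> 'a set) \<Rightarrow> ('a \<Rightarrow> 'a) \<Rightarrow> 'a \<Rightarrow> 'a" where
  "dy_operator \<gamma> A B F z =
     z - resolvent \<gamma> B z
       + resolvent \<gamma> A (2 *\<^sub>R resolvent \<gamma> B z - z - \<gamma> *\<^sub>R F (resolvent \<gamma> B z))"

definition dy_residual ::
  "real \<Rightarrow> ('a::real_inner \<Rightarrow> 'a set) \<Rightarrow> ('a \<Rightarrow> 'a set) \<Rightarrow> ('a \<Rightarrow> 'a) \<Rightarrow> 'a \<Rightarrow> real" where
  "dy_residual \<gamma> A B F z = norm (z - dy_operator \<gamma> A B F z)"

definition dy_x :: "real \<Rightarrow> ('a::real_inner \<Rightarrow> 'a set) \<Rightarrow> 'a \<Rightarrow> 'a" where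
  "dy_x \<gamma> B z = resolvent \<gamma> B z"

definition dy_y ::
  "real \<Rightarrow> ('a::real_inner \<Rightarrow> 'a set) \<Rightarrow> ('a \<Rightarrow> 'a set) \<Rightarrow> ('a \<Rightarrow> 'a) \<Rightarrow> 'a \<Rightarrow> 'a" where
  "dy_y \<gamma> A B F z =
     resolvent \<gamma> A (2 *\<^sub>R dy_x \<gamma> B z - z - \<gamma> *\<^sub>R F (dy_x \<gamma> B z))"

primrec dy_iter ::
  "real \<Rightarrow> ('a::real_inner \<Rightarrow> 'a set) \<Rightarrow> ('a \<Rightarrow> 'a set) \<Rightarrow> ('a \<Rightarrow> 'a) \<Rightarrow> 'a \<Rightarrow> nat \<Rightarrow> 'a" where
  "dy_iter \<gamma> A B F z0 0 = z0"
| "dy_iter \<gamma> A B F z0 (Suc t) =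
     dy_iter \<gamma> A B F z0 t
       + dy_y \<gamma> A B F (dy_iter \<gamma> A B F z0 t) - dy_x \<gamma> B (dy_iter \<gamma> A B F z0 t)"

text \<open>A dataset of size \<open>N\<close> is a function on \<open>{1..N}\<close>.\<close>

definition emp_map :: "nat \<Rightarrow> ('a::real_inner \<Rightarrow> 's \<Rightarrow> 'a) \<Rightarrow> (nat \<Rightarrow> 's) \<Rightarrow> 'a \<Rightarrow> 'a" where
  "emp_map N orc D x = (1 / real N) *\<^sub>R (\<Sum>i=1..N. orc x (D i))"

definition dy_output ::
  "real \<Rightarrow> ('a::real_inner \<Rightarrow> 'a set) \<Rightarrow> ('a \<Rightarrow> 'a set) \<Rightarrow> ('a \<Rightarrow> 's \<Rightarrow> 'a) \<Rightarrow> 'a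
     \<Rightarrow> nat \<Rightarrow> nat \<Rightarrow> (nat \<Rightarrow> 's) \<Rightarrow> 'a \<times> 'a \<times> 'a \<times> 'a" where
  "dy_output \<gamma> A B orc z0 N K D =
     (let F = emp_map N orc D; z = dy_iter \<gamma> A B F z0 K; x = dy_x \<gamma> B z
      in (x, dy_y \<gamma> A B F z, z, F x))"

definition out_x :: "'a \<times> 'a \<times> 'a \<times> 'a \<Rightarrow> 'a" where
  "out_x = (\<lambda>(x, y, z, \<zeta>). x)"

definition out_z :: "'a \<times> 'a \<times> 'a \<times> 'a \<Rightarrow> 'a" where
  "out_z = (\<lambda>(x, y, z, \<zeta>). z)"

definition loss :: "('a::real_inner \<Rightarrow> 's \<Rightarrow> 'a) \<Rightarrow> 'a \<times> 'a \<times> 'a \<times> 'a \<Rightarrow> 's \<Rightarrow> real" where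
  "loss orc = (\<lambda>(x, y, z, \<zeta>) \<xi>. norm (\<zeta> - orc x \<xi>))"

definition emp_loss ::
  "nat \<Rightarrow> ('a::real_inner \<Rightarrow> 's \<Rightarrow> 'a) \<Rightarrow> (nat \<Rightarrow> 's) \<Rightarrow> 'a \<times> 'a \<times> 'a \<times> 'a \<Rightarrow> real" where
  "emp_loss N orc D \<omega> = (1 / real N) * (\<Sum>i=1..N. loss orc \<omega> (D i))"

text \<open>The supremum is taken in the reals: when \<open>A\<close> and \<open>B\<close> are maximally monotone, all \<open>orc x\<close> oscillate by
  at most a fixed constant on \<open>\<Xi>\<close>, all \<open>\<lambda>x. orc x \<xi>\<close> are \<open>\<theta>\<close>-cocoercive and \<open>0 < \<gamma> < 2 \<theta>\<close>, the
  operators \<open>dy_operator \<gamma> A B (emp_map N orc D)\<close> are nonexpansive and the set is bounded.\<close>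

definition sensitivity ::
  "real \<Rightarrow> ('a::real_inner \<Rightarrow> 'a set) \<Rightarrow> ('a \<Rightarrow> 'a set) \<Rightarrow> ('a \<Rightarrow> 's \<Rightarrow> 'a) \<Rightarrow> 's set \<Rightarrow> 'a
     \<Rightarrow> nat \<Rightarrow> nat \<Rightarrow> real" where
  "sensitivity \<gamma> A B orc \<Xi> z0 N K =
     (MAX i\<in>{1..N}. SUP (D, \<xi>)\<in>({1..N} \<rightarrow>\<^sub>E \<Xi>) \<times> \<Xi>.
        norm (out_x (dy_output \<gamma> A B orc z0 N K D)
                - out_x (dy_output \<gamma> A B orc z0 N K (D(i := \<xi>)))))"

definition stab_beta :: "real \<Rightarrow> real \<Rightarrow> nat \<Rightarrow> real \<Rightarrow> real" where
  "stab_beta \<theta> \<sigma> N \<eta> = 2 * \<eta> / \<theta> + \<sigma> / real N"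

definition gen_gap :: "real \<Rightarrow> nat \<Rightarrow> real \<Rightarrow> real \<Rightarrow> real" where
  "gen_gap \<sigma> N \<beta> \<delta> =
     2 * \<beta> + (4 * real N * \<beta> + \<sigma>) * sqrt (ln (1 / \<delta>) / (2 * real N))"

end

theory Submission
  imports Defs
begin

text \<open>Resolvents are nonexpansive, so at a common point \<open>z\<close> the two residuals differ by at most
  \<open>\<gamma> \<parallel>F x - C x\<parallel>\<close>, where \<open>x\<close> is the resolvent of \<open>B\<close> at \<open>z\<close> and \<open>F\<close> the empirical map. As \<open>C x\<close> is
  the mean of the oracle, Jensen's inequality bounds \<open>\<parallel>F x - C x\<parallel>\<close> by the population loss of the
  output. Replacing one sample moves the loss by at most \<open>2 \<eta> / \<theta> + \<sigma> / N\<close>, because oracle and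
  empirical map are \<open>1 / \<theta>\<close>-Lipschitz and the empirical map itself moves by at most \<open>\<sigma> / N\<close>.
  The generalisation bound of Bousquet and Elisseeff for uniformly stable algorithms, obtained
  from McDiarmid's inequality, then compares population and empirical loss.\<close>

subsection \<open>Resolvents\<close>

text \<open>Idea: maximise \<open>b - \<parallel>a + w\<parallel>\<^sup>2 / 4\<close> over the convex hull of the points \<open>(a, w, a \<bullet> w)\<close>. Monotonicity
  gives \<open>b \<le> a \<bullet> w\<close> on the whole hull, so the maximum is at most 0, and the first-order
  optimality condition at a maximiser says that \<open>(a + w) / 2\<close> lies in every ball.\<close>

lemma antimonotone_pairs_common_ball_finite:
  fixes G :: "('a::euclidean_space \<times> 'a) set"
  assumes fin: "finite G"
    and mono: "\<And>a w a' w'. (a, w) \<in> G \<Longrightarrow> (a', w') \<in> G \<Longrightarrow> (a - a') \<bullet> (w - w') \<le> 0"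
  shows "\<exists>x. \<forall>(a, w) \<in> G. (x - a) \<bullet> (x - w) \<le> 0"
proof (cases "G = {}")
  case False
  define T where "T = (\<lambda>(a, w). (a, w, a \<bullet> w)) ` G"
  define S where "S = convex hull T"
  define \<phi> :: "'a \<times> 'a \<times> real \<Rightarrow> real" where
    "\<phi> = (\<lambda>(a, w, b). b - ((1/2) *\<^sub>R (a + w)) \<bullet> ((1/2) *\<^sub>R (a + w)))"
  have TS: "T \<subseteq> S" and convS: "convex S"
    by (auto simp: S_def hull_subset)
  \<comment> \<open>For fixed \<open>(a, w, b)\<close> the condition on \<open>(a', w', b')\<close>
    is linear and cuts out a closed half-space, so the hull inherits it from its generators. Using
    this in one argument and then in the other carries the inequality from \<open>T\<close> to all
    pairs in \<open>S\<close>.\<close>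
  have half: "S \<subseteq> {(a', w', b'). b + b' \<le> a \<bullet> w' + a' \<bullet> w}"
    if "T \<subseteq> {(a', w', b'). b + b' \<le> a \<bullet> w' + a' \<bullet> w}" for a w b
  proof -
    have eq: "{(a', w', b'). b + b' \<le> a \<bullet> w' + a' \<bullet> w} = {q. (- w, - a, 1::real) \<bullet> q \<le> - b}"
      by (auto simp: inner_prod_def inner_commute)
    show ?thesis
      using that unfolding S_def eq by (intro hull_minimal convex_halfspace_le) auto
  qed
  have TT: "T \<subseteq> {(a', w', b'). b + b' \<le> a \<bullet> w' + a' \<bullet> w}" if "(a, w, b) \<in> T" for a w b
    using that mono by (fastforce simp: T_def inner_diff_left inner_diff_right)
  have TS': "b + b' \<le> a \<bullet> w' + a' \<bullet> w" if "(a, w, b) \<in> T" "(a', w', b') \<in> S" for a w b a' w' b'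
    using half[OF TT[OF that(1)]] that(2) by auto
  have SS: "b + b' \<le> a \<bullet> w' + a' \<bullet> w" if "(a, w, b) \<in> S" "(a', w', b') \<in> S" for a w b a' w' b'
  proof -
    have "T \<subseteq> {(a', w', b'). b + b' \<le> a \<bullet> w' + a' \<bullet> w}"
      using TS'[OF _ that(1)] by (auto simp: add.commute)
    from half[OF this] that(2) show ?thesis by auto
  qed
  have "compact S" "S \<noteq> {}"
    using fin False unfolding S_def T_def by (auto intro: finite_imp_compact_convex_hull)
  moreover have "continuous_on S \<phi>"
    unfolding \<phi>_def case_prod_unfold by (intro continuous_intros)
  ultimately obtain p where p: "p \<in> S" "\<And>q. q \<in> S \<Longrightarrow> \<phi> q \<le> \<phi> p"
    using continuous_attains_sup by metis
  obtain a w b where p_eq: "p = (a, w, b)" by (cases p)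
  define c where "c = (1/2) *\<^sub>R (a + w)"
  \<comment> \<open>Pairing \<open>p\<close> with itself doubles both sides of this
    inequality.\<close>
  have "b \<le> a \<bullet> w"
    using SS[of a w b a w b] p(1) by (simp add: p_eq)
  moreover have "c \<bullet> c - a \<bullet> w = (1/4) * ((a - w) \<bullet> (a - w))"
    by (simp add: c_def algebra_simps inner_commute)
  ultimately have bc: "b - c \<bullet> c \<le> 0"
    using inner_ge_zero[of "a - w"] by linarith
  have "(c - a') \<bullet> (c - w') \<le> 0" if G: "(a', w') \<in> G" for a' w'
  proof -
    define q where "q = (a', w', a' \<bullet> w')"
    define c' where "c' = (1/2) *\<^sub>R (a' + w')"
    \<comment> \<open>The derivative of \<open>\<phi>\<close> at \<open>p\<close> in the direction
      \<open>q - p\<close>: along the segment, \<open>\<phi>\<close> changes by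
      \<open>t * \<Delta> - t\<^sup>2 * ((c' - c) \<bullet> (c' - c))\<close>.\<close>
    define \<Delta> where "\<Delta> = (a' \<bullet> w' - b) - 2 * (c \<bullet> (c' - c))"
    have q: "q \<in> S" using TS G by (auto simp: T_def q_def)
    have step: "\<Delta> \<le> t * ((c' - c) \<bullet> (c' - c))" if t: "0 < t" "t \<le> 1" for t
    proof -
      have "(1 - t) *\<^sub>R p + t *\<^sub>R q \<in> S"
        using convS p(1) q t by (intro convexD) auto
      from p(2)[OF this]
      have "\<phi> ((1 - t) *\<^sub>R p + t *\<^sub>R q) \<le> \<phi> p" .
      moreover have "(1/2) *\<^sub>R (((1 - t) *\<^sub>R a + t *\<^sub>R a') + ((1 - t) *\<^sub>R w + t *\<^sub>R w')) = c + t *\<^sub>R (c' - c)"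
        by (simp add: c_def c'_def algebra_simps)
      ultimately have "((1 - t) * b + t * (a' \<bullet> w')) - ((c + t *\<^sub>R (c' - c)) \<bullet> (c + t *\<^sub>R (c' - c))) \<le> b - c \<bullet> c"
        by (simp add: \<phi>_def p_eq q_def del: inner_scaleR_left inner_scaleR_right flip: c_def)
      then have "t * \<Delta> \<le> t * (t * ((c' - c) \<bullet> (c' - c)))"
        by (simp add: \<Delta>_def algebra_simps inner_commute)
      then show ?thesis using t by simp
    qed
    have "\<Delta> \<le> 0"
    proof (rule ccontr)
      assume "\<not> \<Delta> \<le> 0"
      define m where "m = (c' - c) \<bullet> (c' - c)"
      have m: "m \<ge> 0" by (simp add: m_def)
      \<comment> \<open>Any small enough \<open>t\<close> contradicts \<open>\<Delta> > 0\<close>;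
        this one makes \<open>t * m\<close> smaller than \<open>\<Delta>\<close>, and
        \<open>m + 1\<close> keeps the denominator positive when \<open>m = 0\<close>.\<close>
      define t where "t = min 1 (\<Delta> / (2 * (m + 1)))"
      have "0 < t" "t \<le> 1" using \<open>\<not> \<Delta> \<le> 0\<close> m by (auto simp: t_def)
      from step[OF this] have "\<Delta> \<le> t * m" by (simp add: m_def)
      also have "\<dots> \<le> \<Delta> / (2 * (m + 1)) * m" using m by (intro mult_right_mono) (auto simp: t_def)
      also have "\<dots> < \<Delta>" using m \<open>\<not> \<Delta> \<le> 0\<close> by (simp add: field_simps add_nonneg_pos)
      finally show False by simp
    qed
    moreover have "(c - a') \<bullet> (c - w') = \<Delta> + (b - c \<bullet> c)"
      by (simp add: \<Delta>_def c'_def algebra_simps inner_commute)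
    ultimately show ?thesis using bc by linarith
  qed
  then show ?thesis by auto
qed auto

text \<open>By Thales the set is the ball whose diameter is the segment from \<open>a\<close> to
  \<open>w\<close>. Cauchy-Schwarz gives the cruder bound \<open>norm (a - w)\<close> on the
  distance to \<open>a\<close>, which is enough for compactness.\<close>

lemma compact_diameter_ball:
  fixes a w :: "'a::euclidean_space"
  shows "compact {x. (x - a) \<bullet> (x - w) \<le> 0}"
proof -
  have "closed {x. (x - a) \<bullet> (x - w) \<le> 0}"
    by (intro closed_Collect_le continuous_intros)
  moreover have "{x. (x - a) \<bullet> (x - w) \<le> 0} \<subseteq> cball a (norm (a - w))"
  proof clarsimp
    fix x assume le: "(x - a) \<bullet> (x - w) \<le> 0"
    have "(x - a) \<bullet> (x - a) = (x - a) \<bullet> (x - w) + (x - a) \<bullet> (w - a)"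
      by (simp flip: inner_add_right)
    also have "\<dots> \<le> norm (x - a) * norm (w - a)"
      using le norm_cauchy_schwarz[of "x - a" "w - a"] by linarith
    finally have "norm (x - a) * norm (x - a) \<le> norm (x - a) * norm (w - a)"
      by (simp add: dot_square_norm power2_eq_square)
    then have "norm (x - a) \<le> norm (w - a)"
      by (cases "norm (x - a) = 0") auto
    then show "dist a x \<le> norm (a - w)" by (simp add: dist_norm norm_minus_commute)
  qed
  ultimately show ?thesis
    using bounded_subset[OF bounded_cball] by (auto simp: compact_eq_bounded_closed)
qed

text \<open>The point \<open>x\<close> must lie, for every \<open>u \<in> A a\<close>, in the ball with diameter from \<open>a\<close> to \<open>z - \<gamma> u\<close>;
  these balls are compact, so finite intersections suffice.\<close>

lemma minty_surjective:
  fixes A :: "'a::euclidean_space \<Rightarrow> 'a set"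
  assumes A: "maximally_monotone A" and \<gamma>: "\<gamma> > 0"
  shows "\<exists>x. \<exists>u\<in>A x. z = x + \<gamma> *\<^sub>R u"
proof -
  define G where "G = {(a, z - \<gamma> *\<^sub>R u) | a u. u \<in> A a}"
  have monoA: "(x - y) \<bullet> (u - v) \<ge> 0" if "u \<in> A x" "v \<in> A y" for x y u v
    using A that by (auto simp: maximally_monotone_def monotone_operator_def)
  have monoG: "(a - a') \<bullet> (w - w') \<le> 0" if G: "(a, w) \<in> G" "(a', w') \<in> G" for a w a' w'
  proof -
    obtain u v where uv: "u \<in> A a" "v \<in> A a'" "w = z - \<gamma> *\<^sub>R u" "w' = z - \<gamma> *\<^sub>R v"
      using G unfolding G_def by blast
    have "(a - a') \<bullet> (w - w') = - (\<gamma> * ((a - a') \<bullet> (u - v)))"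
      by (simp add: uv algebra_simps)
    also have "\<dots> \<le> 0" using monoA[OF uv(1,2)] \<gamma> by simp
    finally show ?thesis .
  qed
  have "\<Inter>((\<lambda>(a, w). {x. (x - a) \<bullet> (x - w) \<le> 0}) ` G) \<noteq> {}"
  proof (rule compact_fip_Heine_Borel)
    fix \<F> assume "finite \<F>" "\<F> \<subseteq> (\<lambda>(a, w). {x. (x - a) \<bullet> (x - w) \<le> 0}) ` G"
    then obtain H where H: "finite H" "H \<subseteq> G" "\<F> = (\<lambda>(a, w). {x. (x - a) \<bullet> (x - w) \<le> 0}) ` H"
      by (meson finite_subset_image)
    have "\<exists>x. \<forall>(a, w) \<in> H. (x - a) \<bullet> (x - w) \<le> 0"
      using H(2) by (intro antimonotone_pairs_common_ball_finite H(1)) (blast intro: monoG)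
    then show "\<Inter>\<F> \<noteq> {}" unfolding H(3) by fastforce
  qed (auto simp: compact_diameter_ball)
  then obtain x where x: "\<And>a w. (a, w) \<in> G \<Longrightarrow> (x - a) \<bullet> (x - w) \<le> 0" by fastforce
  \<comment> \<open>The only \<open>u\<close> with \<open>z = x + \<gamma> *\<^sub>R u\<close>.
    Lying in all the balls means that \<open>(x, u)\<close> is monotonically related to the whole
    graph of \<open>A\<close>; adding it keeps \<open>A\<close> monotone, so by maximality it was
    there already.\<close>
  define u where "u = (1/\<gamma>) *\<^sub>R (z - x)"
  have zx: "z = x + \<gamma> *\<^sub>R u" using \<gamma> by (simp add: u_def)
  have comp: "(x - y) \<bullet> (u - v) \<ge> 0" if "v \<in> A y" for y v
  proof -
    have "(x - y) \<bullet> (x - (z - \<gamma> *\<^sub>R v)) \<le> 0"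
      using that by (intro x) (auto simp: G_def)
    moreover have "x - (z - \<gamma> *\<^sub>R v) = - (\<gamma> *\<^sub>R (u - v))" by (simp add: zx algebra_simps)
    ultimately show ?thesis using \<gamma> by (simp add: zero_le_mult_iff)
  qed
  have comp': "(y - x) \<bullet> (v - u) \<ge> 0" if "v \<in> A y" for y v
    using comp[OF that] by (simp add: inner_diff_left inner_diff_right)
  have "monotone_operator (A(x := insert u (A x)))"
    unfolding monotone_operator_def using monoA comp comp' by auto
  moreover have "\<forall>y. A y \<subseteq> (A(x := insert u (A x))) y" by auto
  ultimately have "A(x := insert u (A x)) = A"
    using A unfolding maximally_monotone_def by blast
  then have "u \<in> A x" by (metis fun_upd_same insertI1)
  then show ?thesis using zx by blast
qed

text \<open>Pairing the difference on the right with \<open>x - y\<close> gives the square of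
  \<open>norm (x - y)\<close> plus a term that monotonicity makes nonnegative; Cauchy-Schwarz
  finishes. Both uniqueness in the resolvent equation and nonexpansiveness follow from it.\<close>

lemma resolvent_equation_dist_le:
  fixes A :: "'a::real_inner \<Rightarrow> 'a set"
  assumes "monotone_operator A" "\<gamma> > 0" "u \<in> A x" "v \<in> A y"
  shows "norm (x - y) \<le> norm ((x + \<gamma> *\<^sub>R u) - (y + \<gamma> *\<^sub>R v))"
proof -
  have "(x - y) \<bullet> (u - v) \<ge> 0" using assms by (auto simp: monotone_operator_def)
  then have "(x - y) \<bullet> (x - y) \<le> (x - y) \<bullet> ((x + \<gamma> *\<^sub>R u) - (y + \<gamma> *\<^sub>R v))"
    using \<open>\<gamma> > 0\<close> mult_nonneg_nonneg[of \<gamma> "(x - y) \<bullet> (u - v)"]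
    by (simp add: algebra_simps)
  also have "\<dots> \<le> norm (x - y) * norm ((x + \<gamma> *\<^sub>R u) - (y + \<gamma> *\<^sub>R v))"
    by (rule norm_cauchy_schwarz)
  finally show ?thesis
    by (cases "norm (x - y) = 0") (auto simp: dot_square_norm power2_eq_square)
qed

text \<open>Makes the definite description usable: Minty's theorem supplies existence, and two
  solutions for the same \<open>z\<close> have distance 0.\<close>

lemma resolvent_in:
  fixes A :: "'a::euclidean_space \<Rightarrow> 'a set"
  assumes A: "maximally_monotone A" and \<gamma>: "\<gamma> > 0"
  obtains u where "u \<in> A (resolvent \<gamma> A z)" "z = resolvent \<gamma> A z + \<gamma> *\<^sub>R u"
proof -
  have "monotone_operator A" using A by (simp add: maximally_monotone_def)
  from resolvent_equation_dist_le[OF this \<gamma>]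
  have uniq: "x = y" if "u \<in> A x" "v \<in> A y" "x + \<gamma> *\<^sub>R u = y + \<gamma> *\<^sub>R v" for x y u v
    using that by fastforce
  have "\<exists>!x. z \<in> {x + \<gamma> *\<^sub>R u | u. u \<in> A x}"
    using minty_surjective[OF A \<gamma>, of z] uniq by blast
  from theI'[OF this] show ?thesis
    unfolding resolvent_def[symmetric] using that by auto
qed

lemma resolvent_nonexpansive:
  fixes A :: "'a::euclidean_space \<Rightarrow> 'a set"
  assumes "maximally_monotone A" "\<gamma> > 0"
  shows "norm (resolvent \<gamma> A z - resolvent \<gamma> A z') \<le> norm (z - z')"
proof -
  obtain u where u: "u \<in> A (resolvent \<gamma> A z)" "z = resolvent \<gamma> A z + \<gamma> *\<^sub>R u"
    using resolvent_in[OF assms] .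
  obtain v where v: "v \<in> A (resolvent \<gamma> A z')" "z' = resolvent \<gamma> A z' + \<gamma> *\<^sub>R v"
    using resolvent_in[OF assms] .
  have "monotone_operator A" using assms(1) by (simp add: maximally_monotone_def)
  from resolvent_equation_dist_le[OF this assms(2) u(1) v(1)] show ?thesis
    unfolding u(2)[symmetric] v(2)[symmetric] .
qed

subsection \<open>Bounded differences and uniform stability\<close>

text \<open>Induction on the coordinates, averaging out one at a time. With the others fixed,
  \<open>f\<close> stays in an interval of length \<open>c i\<close>, so Hoeffding's lemma costs a
  factor \<open>exp (l\<^sup>2 * (c i)\<^sup>2 / 8)\<close>; the averaged function keeps the
  differences \<open>c j\<close> in the remaining coordinates.\<close>

lemma mcdiarmid_mgf:
  fixes M :: "'i \<Rightarrow> 'a measure" and f :: "('i \<Rightarrow> 'a) \<Rightarrow> real"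
  assumes M: "\<And>i. prob_space (M i)" and "finite I" and l: "l > 0"
    and "f \<in> borel_measurable (PiM I M)"
    and "\<And>x. x \<in> space (PiM I M) \<Longrightarrow> \<bar>f x\<bar> \<le> b"
    and "\<And>i x y. i \<in> I \<Longrightarrow> x \<in> space (PiM I M) \<Longrightarrow> y \<in> space (M i) \<Longrightarrow> \<bar>f x - f (x(i := y))\<bar> \<le> c i"
  shows "(\<integral>\<^sup>+x. exp (l * (f x - integral\<^sup>L (PiM I M) f)) \<partial>PiM I M) \<le> ennreal (exp (l\<^sup>2 * (\<Sum>i\<in>I. (c i)\<^sup>2) / 8))"
  using assms(2,4-)
proof (induction I arbitrary: f rule: finite_induct)
  case empty
  interpret product_prob_space M "{}"
    using M by (auto simp: product_prob_space_def product_sigma_finite_def product_prob_space_axioms_def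
        prob_space_imp_sigma_finite)
  \<comment> \<open>The empty product has a single point, the function that is
    \<open>undefined\<close> everywhere, so \<open>f\<close> equals its mean.\<close>
  have const: "f x = f (\<lambda>_. undefined)" if "x \<in> space (PiM {} M)" for x
    using that by (auto simp: space_PiM)
  have "integral\<^sup>L (PiM {} M) f = integral\<^sup>L (PiM {} M) (\<lambda>_. f (\<lambda>_. undefined))"
    by (intro Bochner_Integration.integral_cong const refl)
  also have "\<dots> = f (\<lambda>_. undefined)" by (simp add: P.prob_space)
  finally show ?case
    by (simp add: space_PiM nn_integral_empty)
next
  case (insert i J f)
  interpret product_prob_space M "insert i J"
    using M by (auto simp: product_prob_space_def product_sigma_finite_def product_prob_space_axioms_def
        prob_space_imp_sigma_finite)
  note [measurable] = insert.prems(1)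
  define g where "g = (\<lambda>x. \<integral>y. f (x(i := y)) \<partial>M i)"
  have upd: "x(i := y) \<in> space (PiM (insert i J) M)" if "x \<in> space (PiM J M)" "y \<in> space (M i)" for x y
    using that by (auto simp: space_PiM PiE_iff extensional_def)
  have int: "integrable (PiM (insert i J) M) f"
    using insert.prems(2) by (intro P.integrable_const_bound[where B = b]) auto
  have meas: "(\<lambda>y. f (x(i := y))) \<in> borel_measurable (M i)" if [measurable]: "x \<in> space (PiM J M)" for x
    by measurable
  have inti: "integrable (M i) (\<lambda>y. f (x(i := y)))" if "x \<in> space (PiM J M)" for x
    using insert.prems(2) upd that meas by (intro M.integrable_const_bound[where B = b]) auto
  have Eg: "integral\<^sup>L (PiM (insert i J) M) f = integral\<^sup>L (PiM J M) g"
    using insert.hyps int unfolding g_def by (rule product_integral_insert)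
  let ?E = "integral\<^sup>L (PiM J M) g"
  have inner: "(\<integral>\<^sup>+y. exp (l * (f (x(i := y)) - g x)) \<partial>M i) \<le> ennreal (exp (l\<^sup>2 * (c i)\<^sup>2 / 8))"
    if x: "x \<in> space (PiM J M)" for x
  proof -
    define h where "h = (\<lambda>y. f (x(i := y)))"
    \<comment> \<open>Hoeffding's lemma needs an explicit interval: it starts at the infimum of the
      slice, and comparing two arbitrary values of coordinate \<open>i\<close> shows that length
      \<open>c i\<close> suffices.\<close>
    define a where "a = Inf (h ` space (M i))"
    have "- b \<le> h y" if "y \<in> space (M i)" for y
      using insert.prems(2)[OF upd[OF x that]] unfolding h_def by linarith
    then have "bdd_below (h ` space (M i))" by (rule bdd_belowI2)
    then have lo: "a \<le> h y" if "y \<in> space (M i)" for y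
      unfolding a_def using that by (intro cINF_lower)
    have hi: "h y \<le> a + c i" if y: "y \<in> space (M i)" for y
    proof -
      have "h y - c i \<le> a" unfolding a_def
      proof (rule cINF_greatest)
        show "space (M i) \<noteq> {}" by (rule M.not_empty)
        fix y' assume y': "y' \<in> space (M i)"
        have "\<bar>f (x(i := y')) - f (x(i := y', i := y))\<bar> \<le> c i"
          by (rule insert.prems(3)[OF insertI1 upd[OF x y'] y])
        then show "h y - c i \<le> h y'" unfolding h_def fun_upd_upd by linarith
      qed
      then show ?thesis by simp
    qed
    interpret h: interval_bounded_random_variable "M i" h a "a + c i"
      using meas[OF x] lo hi by unfold_locales (auto simp: h_def)
    show ?thesis
      using h.Hoeffdings_lemma_nn_integral[OF l] by (simp add: h_def g_def)
  qed
  have "(\<integral>\<^sup>+x. exp (l * (f x - ?E)) \<partial>PiM (insert i J) M)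
      = (\<integral>\<^sup>+x. (\<integral>\<^sup>+y. exp (l * (f (x(i := y)) - ?E)) \<partial>M i) \<partial>PiM J M)"
    using insert.hyps by (intro product_nn_integral_insert) auto
  also have "\<dots> = (\<integral>\<^sup>+x. exp (l * (g x - ?E)) * (\<integral>\<^sup>+y. exp (l * (f (x(i := y)) - g x)) \<partial>M i) \<partial>PiM J M)"
  proof (intro nn_integral_cong)
    fix x assume x: "x \<in> space (PiM J M)"
    note [measurable] = meas[OF x]
    \<comment> \<open>Insert \<open>g x\<close> into the exponent; the factor with
      \<open>g x - ?E\<close> does not depend on \<open>y\<close> and leaves the inner
      integral.\<close>
    have "exp (l * (f (x(i := y)) - ?E)) = exp (l * (g x - ?E)) * exp (l * (f (x(i := y)) - g x))" for y
      by (simp flip: exp_add) (simp add: algebra_simps)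
    then show "(\<integral>\<^sup>+y. exp (l * (f (x(i := y)) - ?E)) \<partial>M i)
        = exp (l * (g x - ?E)) * (\<integral>\<^sup>+y. exp (l * (f (x(i := y)) - g x)) \<partial>M i)"
      by (simp add: ennreal_mult nn_integral_cmult)
  qed
  also have "\<dots> \<le> (\<integral>\<^sup>+x. exp (l * (g x - ?E)) * ennreal (exp (l\<^sup>2 * (c i)\<^sup>2 / 8)) \<partial>PiM J M)"
    using inner by (intro nn_integral_mono mult_left_mono) auto
  also have "\<dots> = (\<integral>\<^sup>+x. exp (l * (g x - ?E)) \<partial>PiM J M) * ennreal (exp (l\<^sup>2 * (c i)\<^sup>2 / 8))"
    unfolding g_def by (intro nn_integral_multc) measurable
  also have "\<dots> \<le> ennreal (exp (l\<^sup>2 * (\<Sum>i\<in>J. (c i)\<^sup>2) / 8)) * ennreal (exp (l\<^sup>2 * (c i)\<^sup>2 / 8))"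
  \<comment> \<open>Averaging over \<open>M i\<close> preserves measurability, the bound
    \<open>b\<close> and the differences \<open>c j\<close>, so the induction hypothesis applies to
    \<open>g\<close>.\<close>
  proof (intro mult_right_mono insert.IH)
    show "g \<in> borel_measurable (PiM J M)" unfolding g_def by measurable
    show "\<bar>g x\<bar> \<le> b" if x: "x \<in> space (PiM J M)" for x
    proof -
      have "\<bar>g x\<bar> \<le> (\<integral>y. \<bar>f (x(i := y))\<bar> \<partial>M i)"
        unfolding g_def by (rule integral_abs_bound)
      also have "\<dots> \<le> b"
        using inti[OF x] by (intro M.integral_le_const AE_I2 insert.prems(2) upd[OF x]) auto
      finally show ?thesis .
    qed
    show "\<bar>g x - g (x(j := y))\<bar> \<le> c j" if j: "j \<in> J" and x: "x \<in> space (PiM J M)" and y: "y \<in> space (M j)" for j x y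
    proof -
      have x': "x(j := y) \<in> space (PiM J M)"
        using j x y by (auto simp: space_PiM PiE_iff extensional_def)
      have ij: "i \<noteq> j" using insert.hyps j by auto
      have le: "\<bar>f (x(i := y')) - f (x(j := y, i := y'))\<bar> \<le> c j" if "y' \<in> space (M i)" for y'
        unfolding fun_upd_twist[OF ij[symmetric]] by (rule insert.prems(3)[OF insertI2[OF j] upd[OF x that] y])
      have "\<bar>g x - g (x(j := y))\<bar> = \<bar>\<integral>y'. f (x(i := y')) - f (x(j := y, i := y')) \<partial>M i\<bar>"
        using inti[OF x] inti[OF x'] by (simp add: g_def)
      also have "\<dots> \<le> (\<integral>y'. \<bar>f (x(i := y')) - f (x(j := y, i := y'))\<bar> \<partial>M i)"
        by (rule integral_abs_bound)
      also have "\<dots> \<le> c j"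
        using inti[OF x] inti[OF x'] by (intro M.integral_le_const AE_I2 le) auto
      finally show ?thesis .
    qed
  qed auto
  also have "\<dots> = ennreal (exp (l\<^sup>2 * (\<Sum>i\<in>insert i J. (c i)\<^sup>2) / 8))"
    using insert.hyps by (simp add: add_divide_distrib exp_add algebra_simps flip: ennreal_mult)
  finally show ?case unfolding Eg .
qed

lemma mcdiarmid:
  fixes M :: "'i \<Rightarrow> 'a measure" and f :: "('i \<Rightarrow> 'a) \<Rightarrow> real"
  assumes M: "\<And>i. prob_space (M i)" and "finite I"
    and f[measurable]: "f \<in> borel_measurable (PiM I M)"
    and "\<And>x. x \<in> space (PiM I M) \<Longrightarrow> \<bar>f x\<bar> \<le> b"
    and "\<And>i x y. i \<in> I \<Longrightarrow> x \<in> space (PiM I M) \<Longrightarrow> y \<in> space (M i) \<Longrightarrow> \<bar>f x - f (x(i := y))\<bar> \<le> c i"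
    and \<epsilon>: "\<epsilon> > 0" and d: "(\<Sum>i\<in>I. (c i)\<^sup>2) > 0"
  shows "\<P>(x in PiM I M. f x \<ge> integral\<^sup>L (PiM I M) f + \<epsilon>) \<le> exp (- 2 * \<epsilon>\<^sup>2 / (\<Sum>i\<in>I. (c i)\<^sup>2))"
proof -
  interpret product_prob_space M I
    using M by (auto simp: product_prob_space_def product_sigma_finite_def product_prob_space_axioms_def
        prob_space_imp_sigma_finite)
  let ?d = "\<Sum>i\<in>I. (c i)\<^sup>2" and ?E = "integral\<^sup>L (PiM I M) f"
  \<comment> \<open>The minimiser of the Chernoff exponent
    \<open>- l * \<epsilon> + l\<^sup>2 * ?d / 8\<close>.\<close>
  define l where "l = 4 * \<epsilon> / ?d"
  have l: "l > 0" using \<epsilon> d by (simp add: l_def)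
  have "{x\<in>space (PiM I M). f x \<ge> ?E + \<epsilon>} = {x\<in>space (PiM I M). f x - ?E \<ge> \<epsilon>}" by auto
  then have "ennreal (P.prob {x\<in>space (PiM I M). f x \<ge> ?E + \<epsilon>}) = emeasure (PiM I M) \<dots>"
    by (simp add: P.emeasure_eq_measure)
  also have "\<dots> \<le> ennreal (exp (- l * \<epsilon>)) * (\<integral>\<^sup>+x\<in>space (PiM I M). exp (l * (f x - ?E)) \<partial>PiM I M)"
    by (intro Chernoff_ineq_nn_integral_ge l) auto
  also have "(\<integral>\<^sup>+x\<in>space (PiM I M). exp (l * (f x - ?E)) \<partial>PiM I M) = (\<integral>\<^sup>+x. exp (l * (f x - ?E)) \<partial>PiM I M)"
    by (intro nn_integral_cong) auto
  also have "ennreal (exp (- l * \<epsilon>)) * \<dots> \<le> ennreal (exp (- l * \<epsilon>)) * ennreal (exp (l\<^sup>2 * ?d / 8))"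
    using assms l by (intro mult_left_mono mcdiarmid_mgf) auto
  also have "\<dots> = ennreal (exp (- l * \<epsilon> + l\<^sup>2 * ?d / 8))"
    by (simp flip: ennreal_mult exp_add)
  also have "- l * \<epsilon> + l\<^sup>2 * ?d / 8 = - 2 * \<epsilon>\<^sup>2 / ?d"
    using d by (simp add: l_def field_simps power2_eq_square)
  finally show ?thesis by (subst (asm) ennreal_le_iff) auto
qed

section \<open>Generalisation from replace-one stability\<close>

text \<open>McDiarmid's inequality is applied to \<open>R - E\<close>, population loss minus
  empirical loss. Stability bounds both the mean of this function, by \<beta>, and its change under
  replacement of one sample, by \<open>2 * \<beta> + m / N\<close>.\<close>

lemma uniform_stability_generalization:
  fixes P :: "'s measure" and I :: "'i set" and L :: "('i \<Rightarrow> 's) \<Rightarrow> 's \<Rightarrow> real"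
  defines "Q \<equiv> PiM I (\<lambda>_. P)" and "N \<equiv> real (card I)"
  assumes P: "prob_space P" and I: "finite I" "I \<noteq> {}"
    and L: "(\<lambda>(D, \<xi>). L D \<xi>) \<in> borel_measurable (Q \<Otimes>\<^sub>M P)"
    and nonneg: "\<And>D \<xi>. D \<in> space Q \<Longrightarrow> \<xi> \<in> space P \<Longrightarrow> 0 \<le> L D \<xi>"
    and le: "\<And>D \<xi>. D \<in> space Q \<Longrightarrow> \<xi> \<in> space P \<Longrightarrow> L D \<xi> \<le> m"
    and stab: "\<And>i D \<xi> \<xi>'. i \<in> I \<Longrightarrow> D \<in> space Q \<Longrightarrow> \<xi> \<in> space P \<Longrightarrow> \<xi>' \<in> space P \<Longrightarrow>
      \<bar>L D \<xi> - L (D(i := \<xi>')) \<xi>\<bar> \<le> \<beta>"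
    and m: "m > 0" and \<delta>: "0 < \<delta>" "\<delta> < 1"
  shows "\<P>(D in Q. (\<integral>\<xi>. L D \<xi> \<partial>P) \<le>
      (\<Sum>i\<in>I. L D (D i)) / N + \<beta> + (2 * N * \<beta> + m) * sqrt (ln (1 / \<delta>) / (2 * N))) \<ge> 1 - \<delta>"
proof -
  interpret P: prob_space P by fact
  interpret product_sigma_finite "\<lambda>_. P"
    by (simp add: product_sigma_finite_def P prob_space_imp_sigma_finite)
  interpret Q: prob_space Q unfolding Q_def by (rule prob_space_PiM) (rule P)
  have N: "N > 0" using I by (simp add: N_def card_gt_0_iff)
  have LM: "(\<lambda>\<omega>. L (g \<omega>) (h \<omega>)) \<in> borel_measurable M" if "g \<in> M \<rightarrow>\<^sub>M Q" "h \<in> M \<rightarrow>\<^sub>M P" for g h M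
    using measurable_compose[OF measurable_Pair[OF that] L] by simp
  have comp: "(\<lambda>D. D i) \<in> Q \<rightarrow>\<^sub>M P" if "i \<in> I" for i
    using that by (simp add: Q_def)
  have compS: "D i \<in> space P" if "i \<in> I" "D \<in> space Q" for i D
    using measurable_space[OF comp] that by simp
  have updQ: "D(i := y) \<in> space Q" if "i \<in> I" "D \<in> space Q" "y \<in> space P" for i D y
    using that by (auto simp: Q_def space_PiM PiE_iff extensional_def)
  obtain i0 where i0: "i0 \<in> I" using I by auto
  obtain D0 where D0: "D0 \<in> space Q" using Q.not_empty by auto
  obtain \<xi>0 where \<xi>0: "\<xi>0 \<in> space P" using P.not_empty by auto
  have \<beta>: "\<beta> \<ge> 0"
    using stab[OF i0 D0 \<xi>0 \<xi>0] abs_ge_zero order_trans by blast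
  define R where "R = (\<lambda>D. \<integral>\<xi>. L D \<xi> \<partial>P)"
  define E where "E = (\<lambda>D. (\<Sum>i\<in>I. L D (D i)) / N)"
  have intL: "integrable P (L D)" if D: "D \<in> space Q" for D
    using nonneg[OF D] le[OF D] D by (intro P.integrable_const_bound[where B = m] AE_I2 LM) auto
  have R_meas[measurable]: "R \<in> borel_measurable Q"
    unfolding R_def by (intro P.borel_measurable_lebesgue_integral L)
  have Li_meas[measurable]: "(\<lambda>D. L D (D i)) \<in> borel_measurable Q" if "i \<in> I" for i
    using comp[OF that] by (intro LM) auto
  have E_meas[measurable]: "E \<in> borel_measurable Q"
    unfolding E_def by measurable
  have R_nonneg: "0 \<le> R D" and R_le: "R D \<le> m" if D: "D \<in> space Q" for D
    using intL[OF D] nonneg[OF D] le[OF D] unfolding R_def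
    by (auto intro!: integral_nonneg_AE P.integral_le_const AE_I2)
  have Li: "0 \<le> L D (D i)" "L D (D i) \<le> m" if "D \<in> space Q" "i \<in> I" for D i
    using nonneg le compS that by auto
  have E_bounds: "0 \<le> E D" "E D \<le> m" if D: "D \<in> space Q" for D
  proof -
    show "0 \<le> E D" unfolding E_def using Li[OF D] N by (auto intro!: divide_nonneg_pos sum_nonneg)
    have "(\<Sum>i\<in>I. L D (D i)) \<le> (\<Sum>i\<in>I. m)" by (intro sum_mono Li[OF D])
    then show "E D \<le> m" unfolding E_def using N by (simp add: N_def field_simps)
  qed
  have R_int: "integrable Q R"
    using R_nonneg R_le by (intro Q.integrable_const_bound[where B = m] AE_I2) auto
  have Li_int: "integrable Q (\<lambda>D. L D (D i))" if "i \<in> I" for i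
    using Li that by (intro Q.integrable_const_bound[where B = m] AE_I2) auto
  \<comment> \<open>Given the other samples, exchange the \<open>i\<close>-th one for the test point
    at cost \<beta>. The test point is then itself the \<open>i\<close>-th sample, and integrating
    over the rest gives the expected training loss at \<open>i\<close>.\<close>
  have ER: "integral\<^sup>L Q R \<le> (\<integral>D. L D (D i) \<partial>Q) + \<beta>" if i: "i \<in> I" for i
  proof -
    define J where "J = I - {i}"
    have J: "finite J" "i \<notin> J" "insert i J = I" using I i by (auto simp: J_def)
    define QJ where "QJ = PiM J (\<lambda>_. P)"
    interpret QJ: prob_space QJ unfolding QJ_def by (rule prob_space_PiM) (rule P)
    have upd: "x(i := y) \<in> space Q" if "x \<in> space QJ" "y \<in> space P" for x y
      using that unfolding Q_def QJ_def J(3)[symmetric] by (auto simp: space_PiM PiE_iff extensional_def)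
    have updM: "(\<lambda>y. x(i := y)) \<in> P \<rightarrow>\<^sub>M Q" if x[measurable]: "x \<in> space (PiM J (\<lambda>_. P))" for x
      unfolding Q_def J(3)[symmetric] by measurable
    have add: "(\<lambda>(x, y). x(i := y)) \<in> QJ \<Otimes>\<^sub>M P \<rightarrow>\<^sub>M Q"
      using measurable_add_dim[of i J "\<lambda>_. P"] unfolding Q_def QJ_def J(3) .
    define g where "g = (\<lambda>x. \<integral>y. R (x(i := y)) \<partial>P)"
    define h where "h = (\<lambda>x. \<integral>y. L (x(i := y)) y \<partial>P)"
    have g_meas: "g \<in> borel_measurable QJ"
      unfolding g_def using measurable_compose[OF add R_meas]
      by (intro P.borel_measurable_lebesgue_integral) (simp add: case_prod_unfold)
    have h_meas: "h \<in> borel_measurable QJ"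
      unfolding h_def using LM[OF add, of snd]
      by (intro P.borel_measurable_lebesgue_integral) (simp add: case_prod_unfold)
    have Rx: "integrable P (\<lambda>y. R (x(i := y)))" if x: "x \<in> space QJ" for x
      using R_nonneg[OF upd[OF x]] R_le[OF upd[OF x]] measurable_compose[OF updM R_meas] x
      unfolding QJ_def by (intro P.integrable_const_bound[where B = m] AE_I2) auto
    have Lx: "integrable P (\<lambda>y. L (x(i := y)) y)" if x: "x \<in> space QJ" for x
      using nonneg[OF upd[OF x]] le[OF upd[OF x]] LM[OF updM measurable_ident] x
      unfolding QJ_def by (intro P.integrable_const_bound[where B = m] AE_I2) auto
    have gh: "g x \<le> h x + \<beta>" if x: "x \<in> space QJ" for x
    proof -
      have "R (x(i := y')) \<le> h x + \<beta>" if y': "y' \<in> space P" for y'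
      proof -
        have pt: "L (x(i := y')) \<xi> \<le> L (x(i := \<xi>)) \<xi> + \<beta>" if \<xi>: "\<xi> \<in> space P" for \<xi>
        proof -
          have "\<bar>L (x(i := y')) \<xi> - L (x(i := y', i := \<xi>)) \<xi>\<bar> \<le> \<beta>"
            by (rule stab[OF i upd[OF x y'] \<xi> \<xi>])
          then show ?thesis unfolding fun_upd_upd by linarith
        qed
        have "R (x(i := y')) \<le> (\<integral>\<xi>. L (x(i := \<xi>)) \<xi> + \<beta> \<partial>P)"
          unfolding R_def using Lx[OF x]
          by (intro integral_mono intL[OF upd[OF x y']] pt Bochner_Integration.integrable_add) auto
        also have "\<dots> = h x + \<beta>" using Lx[OF x] by (simp add: h_def P.prob_space)
        finally show ?thesis .
      qed
      then show ?thesis unfolding g_def by (intro P.integral_le_const Rx[OF x] AE_I2)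
    qed
    have g_int: "integrable QJ g"
    proof (intro QJ.integrable_const_bound[where B = m] AE_I2 g_meas)
      fix x assume x: "x \<in> space QJ"
      have "0 \<le> g x"
        unfolding g_def by (intro integral_nonneg_AE AE_I2 R_nonneg upd[OF x])
      moreover have "g x \<le> m"
        unfolding g_def by (intro P.integral_le_const Rx[OF x] AE_I2 R_le upd[OF x])
      ultimately show "norm (g x) \<le> m" by simp
    qed
    have h_int: "integrable QJ h"
    proof (intro QJ.integrable_const_bound[where B = m] AE_I2 h_meas)
      fix x assume x: "x \<in> space QJ"
      have "0 \<le> h x"
        unfolding h_def by (intro integral_nonneg_AE AE_I2 nonneg upd[OF x])
      moreover have "h x \<le> m"
        unfolding h_def by (intro P.integral_le_const Lx[OF x] AE_I2 le upd[OF x])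
      ultimately show "norm (h x) \<le> m" by simp
    qed
    have "integral\<^sup>L Q R = integral\<^sup>L QJ g"
      using product_integral_insert[OF J(1,2), of R] R_int J(3) by (simp add: Q_def QJ_def g_def)
    also have "\<dots> \<le> (\<integral>x. h x + \<beta> \<partial>QJ)"
      by (intro integral_mono g_int gh Bochner_Integration.integrable_add h_int) auto
    also have "\<dots> = integral\<^sup>L QJ h + \<beta>" using h_int by (simp add: QJ.prob_space)
    also have "integral\<^sup>L QJ h = (\<integral>D. L D (D i) \<partial>Q)"
      using product_integral_insert[OF J(1,2), of "\<lambda>D. L D (D i)"] Li_int[OF i] J(3) by (simp add: Q_def QJ_def h_def)
    finally show ?thesis .
  qed
  define f where "f = (\<lambda>D. R D - E D)"
  have "N * integral\<^sup>L Q R = (\<Sum>i\<in>I. integral\<^sup>L Q R)" by (simp add: N_def)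
  also have "\<dots> \<le> (\<Sum>i\<in>I. (\<integral>D. L D (D i) \<partial>Q) + \<beta>)" by (intro sum_mono ER)
  also have "\<dots> = N * integral\<^sup>L Q E + N * \<beta>"
    using N Li_int by (simp add: E_def sum.distrib N_def)
  finally have "N * integral\<^sup>L Q R \<le> N * (integral\<^sup>L Q E + \<beta>)" by (simp add: algebra_simps)
  moreover have "integrable Q E"
    using E_bounds by (intro Q.integrable_const_bound[where B = m] AE_I2) auto
  ultimately have Ef: "integral\<^sup>L Q f \<le> \<beta>" using N R_int by (simp add: f_def)
  \<comment> \<open>\<open>R\<close> contributes \<beta>, and \<open>E\<close> contributes
    \<open>\<beta> + m / N\<close>.\<close>
  define c where "c = 2 * \<beta> + m / N"
  have c: "c > 0" using \<beta> m N by (simp add: c_def add_nonneg_pos)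
  have diff: "\<bar>f D - f (D(i := y))\<bar> \<le> c" if i: "i \<in> I" and D: "D \<in> space Q" and y: "y \<in> space P" for i D y
  proof -
    let ?D = "D(i := y)"
    have D': "?D \<in> space Q" by (rule updQ[OF i D y])
    have "\<bar>R D - R ?D\<bar> = \<bar>\<integral>\<xi>. L D \<xi> - L ?D \<xi> \<partial>P\<bar>"
      using intL[OF D] intL[OF D'] by (simp add: R_def)
    also have "\<dots> \<le> (\<integral>\<xi>. \<bar>L D \<xi> - L ?D \<xi>\<bar> \<partial>P)" by (rule integral_abs_bound)
    also have "\<dots> \<le> \<beta>"
      using intL[OF D] intL[OF D'] by (intro P.integral_le_const AE_I2 stab[OF i D] y) auto
    finally have dR: "\<bar>R D - R ?D\<bar> \<le> \<beta>" .
    \<comment> \<open>At \<open>j = i\<close> dataset and test point change together, so the range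
      \<open>m\<close> of the loss serves as bound; the \<beta> added there only keeps the sum
      uniform.\<close>
    have term_le: "\<bar>L D (D j) - L ?D (?D j)\<bar> \<le> \<beta> + (if j = i then m else 0)" if j: "j \<in> I" for j
    proof (cases "j = i")
      case True
      then show ?thesis using Li[OF D j] Li[OF D' j] \<beta> by auto
    next
      case False
      then have "?D j = D j" by simp
      then show ?thesis using stab[OF i D compS[OF j D] y] False by simp
    qed
    have "\<bar>E D - E ?D\<bar> = \<bar>\<Sum>j\<in>I. L D (D j) - L ?D (?D j)\<bar> / N"
      unfolding E_def sum_subtractf using N by (simp flip: diff_divide_distrib)
    also have "\<dots> \<le> (\<Sum>j\<in>I. \<beta> + (if j = i then m else 0)) / N"
      using N by (intro divide_right_mono order.trans[OF sum_abs] sum_mono term_le) auto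
    also have "\<dots> = \<beta> + m / N"
      using I i N by (simp add: sum.distrib N_def add_divide_distrib)
    finally show ?thesis using dR unfolding f_def c_def by linarith
  qed
  \<comment> \<open>Chosen so that McDiarmid's exponent
    \<open>2 * \<epsilon>\<^sup>2 / (N * c\<^sup>2)\<close> equals \<open>ln (1 / \<delta>)\<close>;
    note \<open>N * c = 2 * N * \<beta> + m\<close>.\<close>
  define \<epsilon> where "\<epsilon> = (2 * N * \<beta> + m) * sqrt (ln (1 / \<delta>) / (2 * N))"
  have pos: "2 * N * \<beta> + m > 0" using N \<beta> m by (simp add: add_nonneg_pos)
  have ln_pos: "ln (1 / \<delta>) > 0" using \<delta> by simp
  have \<epsilon>: "\<epsilon> > 0" using pos ln_pos N by (simp add: \<epsilon>_def)
  have d: "(\<Sum>i\<in>I. c\<^sup>2) = (2 * N * \<beta> + m)\<^sup>2 / N"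
    using N by (simp add: N_def[symmetric] c_def field_simps power2_eq_square)
  have "2 * \<epsilon>\<^sup>2 / (\<Sum>i\<in>I. c\<^sup>2) = ln (1 / \<delta>)"
  proof -
    have "\<epsilon>\<^sup>2 = (2 * N * \<beta> + m)\<^sup>2 * (ln (1 / \<delta>) / (2 * N))"
      using ln_pos N by (simp add: \<epsilon>_def power_mult_distrib)
    then show ?thesis unfolding d using pos N by (simp add: field_simps)
  qed
  then have exp_eq: "exp (- 2 * \<epsilon>\<^sup>2 / (\<Sum>i\<in>I. c\<^sup>2)) = \<delta>"
    using \<delta> by (simp add: exp_minus)
  have "\<P>(D in Q. f D \<ge> integral\<^sup>L Q f + \<epsilon>) \<le> exp (- 2 * \<epsilon>\<^sup>2 / (\<Sum>i\<in>I. c\<^sup>2))"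
    unfolding Q_def
  proof (rule mcdiarmid[where b = m])
    show "f \<in> borel_measurable (PiM I (\<lambda>_. P))"
      unfolding f_def Q_def[symmetric] by measurable
    show "\<bar>f D\<bar> \<le> m" if "D \<in> space (PiM I (\<lambda>_. P))" for D
      using R_nonneg[of D] R_le[of D] E_bounds[of D] that unfolding f_def Q_def[symmetric] by auto
    show "\<bar>f D - f (D(i := y))\<bar> \<le> c" if "i \<in> I" "D \<in> space (PiM I (\<lambda>_. P))" "y \<in> space P" for i D y
      using diff that unfolding Q_def by blast
    show "(\<Sum>i\<in>I. c\<^sup>2) > 0" unfolding d using pos N by simp
  qed (use P I \<epsilon> in auto)
  then have "1 - \<delta> \<le> 1 - Q.prob {D \<in> space Q. f D \<ge> integral\<^sup>L Q f + \<epsilon>}"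
    unfolding exp_eq by linarith
  also have "\<dots> = Q.prob {D \<in> space Q. \<not> f D \<ge> integral\<^sup>L Q f + \<epsilon>}"
    by (intro Q.prob_neg[symmetric]) (unfold f_def, measurable)
  also have "\<dots> \<le> Q.prob {D \<in> space Q. R D \<le> E D + \<beta> + \<epsilon>}"
    using Ef by (intro Q.finite_measure_mono) (auto simp: f_def)
  finally show ?thesis by (simp add: R_def E_def \<epsilon>_def)
qed

subsection \<open>The Davis--Yin iteration\<close>

text \<open>\<open>X\<close> is a pointwise limit of simple functions. With one of these in place of
  \<open>X\<close>, the composition is pieced together from finitely many measurable functions, and
  continuity in the first argument carries measurability to the limit.\<close>

lemma measurable_caratheodory:
  fixes f :: "'a::{metric_space, second_countable_topology} \<Rightarrow> 's \<Rightarrow> 'b::{metric_space}"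
  assumes meas: "\<And>x. f x \<in> borel_measurable P"
    and cont: "\<And>\<xi>. \<xi> \<in> space P \<Longrightarrow> continuous_on UNIV (\<lambda>x. f x \<xi>)"
    and X[measurable]: "X \<in> borel_measurable M" and Y[measurable]: "Y \<in> M \<rightarrow>\<^sub>M P"
  shows "(\<lambda>\<omega>. f (X \<omega>) (Y \<omega>)) \<in> borel_measurable M"
proof -
  obtain F where F: "\<And>i. simple_function M (F i)" "\<And>\<omega>. \<omega> \<in> space M \<Longrightarrow> (\<lambda>i. F i \<omega>) \<longlonglongrightarrow> X \<omega>"
    using borel_measurable_implies_sequence_metric[OF X, of undefined] by auto
  have [measurable]: "f x \<in> borel_measurable P" for x by (rule meas)
  have "(\<lambda>\<omega>. f (F i \<omega>) (Y \<omega>)) \<in> borel_measurable M" for i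
  proof (rule measurable_compose_countable'[where f = "\<lambda>x \<omega>. f x (Y \<omega>)" and g = "F i" and I = "F i ` space M"])
    show "F i \<in> M \<rightarrow>\<^sub>M count_space (F i ` space M)"
      using F(1)[of i] by (simp add: simple_function_def measurable_count_space_eq2)
    show "countable (F i ` space M)"
      using F(1)[of i] by (simp add: simple_function_def countable_finite)
  qed measurable
  moreover have "(\<lambda>i. f (F i \<omega>) (Y \<omega>)) \<longlonglongrightarrow> f (X \<omega>) (Y \<omega>)" if "\<omega> \<in> space M" for \<omega>
  proof -
    have "Y \<omega> \<in> space P" using Y that by (rule measurable_space)
    then show ?thesis
      using continuous_on_tendsto_compose[OF cont F(2)[OF that]] by simp
  qed
  ultimately show ?thesis by (rule borel_measurable_LIMSEQ_metric)
qed

lemma cocoercive_lipschitz: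
  assumes "cocoercive \<theta> F" "\<theta> > 0"
  shows "norm (F x - F y) \<le> norm (x - y) / \<theta>"
proof -
  have "\<theta> * (norm (F x - F y))\<^sup>2 \<le> (x - y) \<bullet> (F x - F y)"
    using assms by (simp add: cocoercive_def)
  also have "\<dots> \<le> norm (x - y) * norm (F x - F y)" by (rule norm_cauchy_schwarz)
  finally have "(\<theta> * norm (F x - F y)) * norm (F x - F y) \<le> norm (x - y) * norm (F x - F y)"
    by (simp add: power2_eq_square mult.assoc)
  then have "\<theta> * norm (F x - F y) \<le> norm (x - y)"
    by (cases "norm (F x - F y) = 0") (auto simp: mult_le_cancel_right)
  then show ?thesis using assms by (simp add: field_simps)
qed

lemma lipschitz_imp_continuous_on:
  fixes F :: "'a::real_normed_vector \<Rightarrow> 'b::real_normed_vector"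
  assumes "\<And>x y. norm (F x - F y) \<le> c * norm (x - y)" "c \<ge> 0"
  shows "continuous_on UNIV F"
  using assms by (intro lipschitz_on_continuous_on[of c]) (auto simp: lipschitz_on_def dist_norm)

lemma cocoercive_continuous_on:
  fixes F :: "'a::real_inner \<Rightarrow> 'a"
  assumes "cocoercive \<theta> F" "\<theta> > 0"
  shows "continuous_on UNIV F"
  using cocoercive_lipschitz[OF assms] assms(2)
  by (intro lipschitz_imp_continuous_on[of _ "1 / \<theta>"]) auto

lemma resolvent_continuous_on:
  fixes A :: "'a::euclidean_space \<Rightarrow> 'a set"
  assumes "maximally_monotone A" "\<gamma> > 0"
  shows "continuous_on UNIV (resolvent \<gamma> A)"
  using resolvent_nonexpansive[OF assms] by (intro lipschitz_imp_continuous_on[of _ 1]) auto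

text \<open>The bound grows exponentially with \<open>t\<close>; it only serves to show that the supremum in the
  sensitivity is that of a bounded set.\<close>

lemma dy_iter_dist_le:
  fixes A B :: "'a::euclidean_space \<Rightarrow> 'a set"
  assumes A: "maximally_monotone A" and B: "maximally_monotone B" and \<gamma>: "\<gamma> > 0" and c: "c \<ge> 0"
    and lip: "\<And>x y. norm (F x - F y) \<le> c * norm (x - y)"
    and close: "\<And>x. norm (F x - F' x) \<le> e"
  shows "norm (dy_iter \<gamma> A B F z0 t - dy_iter \<gamma> A B F' z0 t) \<le> \<gamma> * e * (\<Sum>s<t. (5 + \<gamma> * c) ^ s)"
proof (induction t)
  case (Suc t)
  define z z' where "z = dy_iter \<gamma> A B F z0 t" and "z' = dy_iter \<gamma> A B F' z0 t"
  define x x' where "x = dy_x \<gamma> B z" and "x' = dy_x \<gamma> B z'"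
  define y y' where "y = dy_y \<gamma> A B F z" and "y' = dy_y \<gamma> A B F' z'"
  define dz where "dz = norm (z - z')"
  have dx: "norm (x - x') \<le> dz"
    unfolding x_def x'_def dy_x_def dz_def by (rule resolvent_nonexpansive[OF B \<gamma>])
  \<comment> \<open>Going through \<open>F x'\<close> takes the Lipschitz bound from
    \<open>F\<close> alone; \<open>F'\<close> enters only by its closeness to
    \<open>F\<close>.\<close>
  have dF: "norm (F x - F' x') \<le> c * dz + e"
  proof -
    have "norm (F x - F' x') \<le> norm (F x - F x') + norm (F x' - F' x')"
      using norm_triangle_ineq[of "F x - F x'" "F x' - F' x'"] by simp
    also have "\<dots> \<le> c * dz + e"
      using lip[of x x'] close[of x'] mult_left_mono[OF dx c] by linarith
    finally show ?thesis .
  qed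
  have "norm (y - y') \<le> norm ((2 *\<^sub>R x - z - \<gamma> *\<^sub>R F x) - (2 *\<^sub>R x' - z' - \<gamma> *\<^sub>R F' x'))"
    unfolding y_def y'_def x_def x'_def dy_y_def by (rule resolvent_nonexpansive[OF A \<gamma>])
  also have "(2 *\<^sub>R x - z - \<gamma> *\<^sub>R F x) - (2 *\<^sub>R x' - z' - \<gamma> *\<^sub>R F' x')
      = (2 *\<^sub>R (x - x') - (z - z')) - \<gamma> *\<^sub>R (F x - F' x')"
    by (simp add: algebra_simps)
  also have "norm \<dots> \<le> norm (2 *\<^sub>R (x - x')) + norm (z - z') + norm (\<gamma> *\<^sub>R (F x - F' x'))"
    by (intro order.trans[OF norm_triangle_ineq4] add_mono norm_triangle_ineq4 order.refl)
  also have "\<dots> \<le> 2 * dz + dz + \<gamma> * (c * dz + e)"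
    using dx dF \<gamma> by (auto simp: dz_def intro!: add_mono mult_left_mono)
  finally have dy: "norm (y - y') \<le> 2 * dz + dz + \<gamma> * (c * dz + e)" .
  have "norm ((z + y - x) - (z' + y' - x')) = norm (((z - z') + (y - y')) - (x - x'))"
    by (simp add: algebra_simps)
  also have "\<dots> \<le> norm (z - z') + norm (y - y') + norm (x - x')"
    by (intro order.trans[OF norm_triangle_ineq4] add_mono norm_triangle_ineq order.refl)
  \<comment> \<open>The 5 counts one \<open>dz\<close> from \<open>z\<close>, one from
    \<open>x\<close> and three from \<open>y\<close>, two of these from the reflection
    \<open>2 *\<^sub>R x\<close>; \<open>\<gamma> * c\<close> comes from the forward step.\<close>
  also have "\<dots> \<le> dz * (5 + \<gamma> * c) + \<gamma> * e"
    using dx dy by (simp add: dz_def algebra_simps)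
  also have "\<dots> \<le> (\<gamma> * e * (\<Sum>s<t. (5 + \<gamma> * c) ^ s)) * (5 + \<gamma> * c) + \<gamma> * e"
    using Suc \<gamma> c by (intro add_right_mono mult_right_mono) (auto simp: dz_def z_def z'_def)
  \<comment> \<open>Splitting off \<open>s = 0\<close> shows that the geometric sum obeys the same
    recursion: multiply by \<open>5 + \<gamma> * c\<close>, add 1.\<close>
  also have "\<dots> = \<gamma> * e * (\<Sum>s<Suc t. (5 + \<gamma> * c) ^ s)"
    by (subst sum.lessThan_Suc_shift) (simp add: algebra_simps sum_distrib_left sum_distrib_right)
  finally show ?case
    by (simp add: z_def z'_def y_def y'_def x_def x'_def)
qed simp

section \<open>The empirical map and the loss of the output\<close>

text \<open>Serves twice: for the Lipschitz constant of the empirical map, and with constant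
  \<open>v\<close> for the bound \<sigma> on the loss.\<close>

lemma norm_mean_diff_le:
  fixes u v :: "nat \<Rightarrow> 'a::real_normed_vector"
  assumes "N \<ge> 1" "\<And>i. i \<in> {1..N} \<Longrightarrow> norm (u i - v i) \<le> c"
  shows "norm ((1 / real N) *\<^sub>R (\<Sum>i=1..N. u i) - (1 / real N) *\<^sub>R (\<Sum>i=1..N. v i)) \<le> c"
proof -
  have "norm ((1 / real N) *\<^sub>R (\<Sum>i=1..N. u i) - (1 / real N) *\<^sub>R (\<Sum>i=1..N. v i))
      = (1 / real N) * norm (\<Sum>i=1..N. u i - v i)"
    by (simp add: sum_subtractf flip: scaleR_diff_right)
  also have "\<dots> \<le> (1 / real N) * (\<Sum>i=1..N. c)"
    using assms(2) by (intro mult_left_mono sum_norm_le) auto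
  also have "\<dots> = c" using assms(1) by simp
  finally show ?thesis .
qed

lemma emp_map_lipschitz:
  assumes "N \<ge> 1" "\<theta> > 0" "\<And>i. i \<in> {1..N} \<Longrightarrow> cocoercive \<theta> (\<lambda>x. orc x (D i))"
  shows "norm (emp_map N orc D x - emp_map N orc D y) \<le> norm (x - y) / \<theta>"
  unfolding emp_map_def using assms by (intro norm_mean_diff_le cocoercive_lipschitz)

lemma emp_map_replace_le:
  assumes "i \<in> {1..N}" "norm (orc x (D i) - orc x \<xi>) \<le> \<sigma>"
  shows "norm (emp_map N orc D x - emp_map N orc (D(i := \<xi>)) x) \<le> \<sigma> / real N"
proof -
  have "(\<Sum>j=1..N. orc x (D j)) - (\<Sum>j=1..N. orc x ((D(i := \<xi>)) j))
      = (\<Sum>j=1..N. if j = i then orc x (D i) - orc x \<xi> else 0)"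
    unfolding sum_subtractf[symmetric] by (intro sum.cong) auto
  also have "\<dots> = orc x (D i) - orc x \<xi>" using assms(1) by simp
  finally have "emp_map N orc D x - emp_map N orc (D(i := \<xi>)) x = (1 / real N) *\<^sub>R (orc x (D i) - orc x \<xi>)"
    unfolding emp_map_def by (simp flip: scaleR_diff_right)
  then show ?thesis using assms by (simp add: divide_right_mono)
qed

lemma loss_dy_output:
  "loss orc (dy_output \<gamma> A B orc z0 N K D) \<xi> =
     norm (emp_map N orc D (out_x (dy_output \<gamma> A B orc z0 N K D)) - orc (out_x (dy_output \<gamma> A B orc z0 N K D)) \<xi>)"
  by (simp add: loss_def dy_output_def out_x_def Let_def)

lemma out_x_dy_output:
  "out_x (dy_output \<gamma> A B orc z0 N K D) = resolvent \<gamma> B (dy_iter \<gamma> A B (emp_map N orc D) z0 K)"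
  by (simp add: dy_output_def out_x_def Let_def dy_x_def)

lemma out_z_dy_output:
  "out_z (dy_output \<gamma> A B orc z0 N K D) = dy_iter \<gamma> A B (emp_map N orc D) z0 K"
  by (simp add: dy_output_def out_z_def Let_def)

text \<open>At a common \<open>z\<close> the two operators differ only inside the outer resolvent,
  whose arguments are \<open>\<gamma> *\<^sub>R (F ?x - F' ?x)\<close> apart; nonexpansiveness and
  the triangle inequality do the rest.\<close>

lemma dy_residual_diff_le:
  fixes A B :: "'a::euclidean_space \<Rightarrow> 'a set"
  assumes "maximally_monotone A" "\<gamma> > 0"
  shows "dy_residual \<gamma> A B F z \<le>
    dy_residual \<gamma> A B F' z + \<gamma> * norm (F' (resolvent \<gamma> B z) - F (resolvent \<gamma> B z))"
proof -
  let ?x = "resolvent \<gamma> B z"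
  have "norm (dy_operator \<gamma> A B F' z - dy_operator \<gamma> A B F z)
      \<le> norm ((2 *\<^sub>R ?x - z - \<gamma> *\<^sub>R F' ?x) - (2 *\<^sub>R ?x - z - \<gamma> *\<^sub>R F ?x))"
    unfolding dy_operator_def by (rule order.trans[OF _ resolvent_nonexpansive[OF assms]]) simp
  also have "\<dots> = norm (\<gamma> *\<^sub>R (F ?x - F' ?x))" by (simp add: algebra_simps)
  also have "\<dots> = \<gamma> * norm (F' ?x - F ?x)" using assms(2) by (simp add: norm_minus_commute)
  finally show ?thesis
    unfolding dy_residual_def
    using norm_triangle_ineq[of "z - dy_operator \<gamma> A B F' z" "dy_operator \<gamma> A B F' z - dy_operator \<gamma> A B F z"]
    by simp
qed

section \<open>Measurability in the dataset\<close>

text \<open>The evaluation point varies with the dataset, so measurability of each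
  \<open>orc x\<close> must be combined with continuity in \<open>x\<close>, which cocoercivity
  provides.\<close>

lemma emp_map_measurable:
  fixes orc :: "'a::euclidean_space \<Rightarrow> 's \<Rightarrow> 'a"
  assumes orc: "\<And>x. orc x \<in> borel_measurable P" "\<theta> > 0"
    "\<And>\<xi>. \<xi> \<in> space P \<Longrightarrow> cocoercive \<theta> (\<lambda>x. orc x \<xi>)"
    and X: "X \<in> borel_measurable (PiM {1..N} (\<lambda>_. P))"
  shows "(\<lambda>D. emp_map N orc D (X D)) \<in> borel_measurable (PiM {1..N} (\<lambda>_. P))"
proof -
  have "(\<lambda>D. orc (X D) (D i)) \<in> borel_measurable (PiM {1..N} (\<lambda>_. P))" if i: "i \<in> {1..N}" for i
    using orc(1) cocoercive_continuous_on[OF orc(3,2)] X measurable_component_singleton[OF i]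
    by (rule measurable_caratheodory)
  then show ?thesis
    unfolding emp_map_def by (intro borel_measurable_scaleR borel_measurable_const borel_measurable_sum)
qed

lemma dy_iter_measurable:
  fixes orc :: "'a::euclidean_space \<Rightarrow> 's \<Rightarrow> 'a"
  assumes orc: "\<And>x. orc x \<in> borel_measurable P" "\<theta> > 0"
    "\<And>\<xi>. \<xi> \<in> space P \<Longrightarrow> cocoercive \<theta> (\<lambda>x. orc x \<xi>)"
    and A: "maximally_monotone A" and B: "maximally_monotone B" and \<gamma>: "\<gamma> > 0"
  shows "(\<lambda>D. dy_iter \<gamma> A B (emp_map N orc D) z0 t) \<in> borel_measurable (PiM {1..N} (\<lambda>_. P))"
proof (induction t)
  case (Suc t)
  note [measurable] = Suc emp_map_measurable[OF orc]
    borel_measurable_continuous_onI[OF resolvent_continuous_on[OF A \<gamma>]]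
    borel_measurable_continuous_onI[OF resolvent_continuous_on[OF B \<gamma>]]
  show ?case unfolding dy_iter.simps dy_x_def dy_y_def by measurable
qed simp

lemma loss_nonneg: "loss orc \<omega> \<xi> \<ge> 0"
  by (simp add: loss_def case_prod_unfold)

text \<open>A supremum of reals dominates its members only when they are bounded above. The crude
  growth estimate for the iterates gives a bound independent of the dataset and of the new
  sample.\<close>

lemma sensitivity_upper:
  fixes A B :: "'a::euclidean_space \<Rightarrow> 'a set"
  assumes N: "N \<ge> 1" and \<theta>: "\<theta> > 0" and A: "maximally_monotone A" and B: "maximally_monotone B" and \<gamma>: "\<gamma> > 0"
    and osc: "\<And>x \<xi> \<xi>'. \<xi> \<in> \<Xi> \<Longrightarrow> \<xi>' \<in> \<Xi> \<Longrightarrow> norm (orc x \<xi> - orc x \<xi>') \<le> \<sigma>"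
    and coc: "\<And>\<xi>. \<xi> \<in> \<Xi> \<Longrightarrow> cocoercive \<theta> (\<lambda>x. orc x \<xi>)"
    and i: "i \<in> {1..N}" and D: "D \<in> {1..N} \<rightarrow>\<^sub>E \<Xi>" and \<xi>: "\<xi> \<in> \<Xi>"
  shows "norm (out_x (dy_output \<gamma> A B orc z0 N K D) - out_x (dy_output \<gamma> A B orc z0 N K (D(i := \<xi>))))
    \<le> sensitivity \<gamma> A B orc \<Xi> z0 N K"
proof -
  define g where "g = (\<lambda>i (D, \<xi>). norm (out_x (dy_output \<gamma> A B orc z0 N K D)
    - out_x (dy_output \<gamma> A B orc z0 N K (D(i := \<xi>)))))"
  \<comment> \<open>The estimate of \<open>dy_iter_dist_le\<close> with Lipschitz constant
    \<open>1 / \<theta>\<close> and perturbation \<open>\<sigma> / real N\<close>.\<close>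
  define b where "b = \<gamma> * (\<sigma> / real N) * (\<Sum>s<K. (5 + \<gamma> * (1 / \<theta>)) ^ s)"
  have "g i p \<le> b" if p: "p \<in> ({1..N} \<rightarrow>\<^sub>E \<Xi>) \<times> \<Xi>" for p
  proof -
    obtain D \<xi> where p_eq: "p = (D, \<xi>)" and D: "D \<in> {1..N} \<rightarrow>\<^sub>E \<Xi>" and \<xi>: "\<xi> \<in> \<Xi>"
      using p by auto
    have D\<Xi>: "D j \<in> \<Xi>" if "j \<in> {1..N}" for j using D that by auto
    have "g i p \<le> norm (dy_iter \<gamma> A B (emp_map N orc D) z0 K - dy_iter \<gamma> A B (emp_map N orc (D(i := \<xi>))) z0 K)"
      using resolvent_nonexpansive[OF B \<gamma>] by (simp add: g_def p_eq out_x_dy_output)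
    also have "\<dots> \<le> b" unfolding b_def
    proof (rule dy_iter_dist_le[OF A B \<gamma>])
      show "norm (emp_map N orc D x - emp_map N orc D y) \<le> 1 / \<theta> * norm (x - y)" for x y
        using emp_map_lipschitz[where orc = orc and D = D, OF N \<theta> coc[OF D\<Xi>], of x y] by simp
      show "norm (emp_map N orc D x - emp_map N orc (D(i := \<xi>)) x) \<le> \<sigma> / real N" for x
        by (intro emp_map_replace_le i osc D\<Xi> \<xi>)
    qed (use \<theta> in simp)
    finally show ?thesis .
  qed
  then have bdd: "bdd_above (g i ` (({1..N} \<rightarrow>\<^sub>E \<Xi>) \<times> \<Xi>))" by (rule bdd_aboveI2)
  have "norm (out_x (dy_output \<gamma> A B orc z0 N K D) - out_x (dy_output \<gamma> A B orc z0 N K (D(i := \<xi>)))) = g i (D, \<xi>)"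
    by (simp add: g_def)
  also have "\<dots> \<le> (SUP p\<in>({1..N} \<rightarrow>\<^sub>E \<Xi>) \<times> \<Xi>. g i p)"
    using D \<xi> by (intro cSUP_upper bdd) auto
  also have "\<dots> \<le> (MAX i\<in>{1..N}. SUP p\<in>({1..N} \<rightarrow>\<^sub>E \<Xi>) \<times> \<Xi>. g i p)"
    using i by (intro Max_ge) auto
  also have "\<dots> = sensitivity \<gamma> A B orc \<Xi> z0 N K"
    unfolding sensitivity_def g_def ..
  finally show ?thesis .
qed

theorem theorem1:
  fixes A B :: "real ^ 'n \<Rightarrow> (real ^ 'n) set"
    and C :: "real ^ 'n \<Rightarrow> real ^ 'n"
    and \<Xi> :: "(real ^ 'd) set"
    and P :: "(real ^ 'd) measure"
    and orc :: "real ^ 'n \<Rightarrow> real ^ 'd \<Rightarrow> real ^ 'n"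
    and z0 :: "real ^ 'n"
    and N K :: nat
    and \<gamma> \<theta> \<sigma> \<delta> :: real
  assumes "N \<ge> 1" and "\<theta> > 0" and "\<sigma> > 0"
    and "0 < \<gamma>" and "\<gamma> < 2 * \<theta>"
    and "0 < \<delta>" and "\<delta> < 1"
    and "maximally_monotone A" and "maximally_monotone B"
    and "cocoercive \<theta> C"
    and "zer_sum A B C \<noteq> {}"
    and "prob_space P" and "space P = \<Xi>"
    and "\<And>x. orc x \<in> borel_measurable P"
    and "\<And>x. has_bochner_integral P (orc x) (C x)"
    and "\<And>x \<xi> \<xi>'. \<xi> \<in> \<Xi> \<Longrightarrow> \<xi>' \<in> \<Xi> \<Longrightarrow> norm (orc x \<xi> - orc x \<xi>') \<le> \<sigma>"
    and "\<And>\<xi>. \<xi> \<in> \<Xi> \<Longrightarrow> cocoercive \<theta> (\<lambda>x. orc x \<xi>)"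
  shows "\<P>(D in (\<Pi>\<^sub>M i\<in>{1..N}. P).
      dy_residual \<gamma> A B C (out_z (dy_output \<gamma> A B orc z0 N K D))
        \<le> dy_residual \<gamma> A B (emp_map N orc D) (out_z (dy_output \<gamma> A B orc z0 N K D))
          + \<gamma> * (emp_loss N orc D (dy_output \<gamma> A B orc z0 N K D)
                 + gen_gap \<sigma> N (stab_beta \<theta> \<sigma> N (sensitivity \<gamma> A B orc \<Xi> z0 N K)) \<delta>))
    \<ge> 1 - \<delta>"
proof -
  note N = \<open>N \<ge> 1\<close> and \<theta> = \<open>\<theta> > 0\<close> and \<gamma> = \<open>0 < \<gamma>\<close> and A = \<open>maximally_monotone A\<close>
    and B = \<open>maximally_monotone B\<close> and osc = assms(16)
  have coc: "cocoercive \<theta> (\<lambda>x. orc x \<xi>)" if "\<xi> \<in> space P" for \<xi>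
    using that assms(13,17) by simp
  interpret P: prob_space P by fact
  define Q where "Q = (\<Pi>\<^sub>M i\<in>{1..N}. P)"
  interpret Q: prob_space Q unfolding Q_def by (rule prob_space_PiM) (rule assms(12))
  define out where "out = (\<lambda>D. dy_output \<gamma> A B orc z0 N K D)"
  define \<eta> where "\<eta> = sensitivity \<gamma> A B orc \<Xi> z0 N K"
  define \<beta> where "\<beta> = stab_beta \<theta> \<sigma> N \<eta>"
  define L where "L = (\<lambda>D. loss orc (out D))"
  let ?x = "\<lambda>D. out_x (out D)" and ?F = "emp_map N orc"
  have spQ: "space Q = {1..N} \<rightarrow>\<^sub>E \<Xi>" by (simp add: Q_def space_PiM assms(13))
  have DX: "D i \<in> \<Xi>" if "D \<in> space Q" "i \<in> {1..N}" for D i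
    using that by (auto simp: spQ)
  have L_eq: "L D \<xi> = norm (?F D (?x D) - orc (?x D) \<xi>)" for D \<xi>
    unfolding L_def out_def by (rule loss_dy_output)
  have \<eta>: "norm (?x D - ?x (D(i := \<xi>))) \<le> \<eta>" if "i \<in> {1..N}" "D \<in> space Q" "\<xi> \<in> \<Xi>" for i D \<xi>
    using that unfolding out_def \<eta>_def spQ
    by (intro sensitivity_upper[OF N \<theta> A B \<gamma>, where \<sigma> = \<sigma>] osc assms(17))
  \<comment> \<open>Three changes add up to \<beta>: the old empirical map moves by
    \<open>\<eta> / \<theta>\<close> between the two outputs, swapping the sample costs
    \<open>\<sigma> / real N\<close> at the new output, and the oracle moves by
    \<open>\<eta> / \<theta>\<close>.\<close>
  have stab: "\<bar>L D \<xi> - L (D(i := \<xi>')) \<xi>\<bar> \<le> \<beta>"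
    if i: "i \<in> {1..N}" and D: "D \<in> space Q" and \<xi>: "\<xi> \<in> \<Xi>" and \<xi>': "\<xi>' \<in> \<Xi>" for i D \<xi> \<xi>'
  proof -
    let ?D = "D(i := \<xi>')"
    have x: "norm (?x D - ?x ?D) / \<theta> \<le> \<eta> / \<theta>" using \<eta>[OF i D \<xi>'] \<theta> by (simp add: divide_right_mono)
    have "norm (?F D (?x D) - ?F D (?x ?D)) \<le> \<eta> / \<theta>"
      using emp_map_lipschitz[where orc = orc and D = D, OF N \<theta> assms(17)[OF DX[OF D]], of "?x D" "?x ?D"] x by (rule order.trans)
    moreover have "norm (?F D (?x ?D) - ?F ?D (?x ?D)) \<le> \<sigma> / real N"
      by (intro emp_map_replace_le i osc DX D \<xi>')
    moreover have "norm (orc (?x D) \<xi> - orc (?x ?D) \<xi>) \<le> \<eta> / \<theta>"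
      using cocoercive_lipschitz[OF assms(17)[OF \<xi>] \<theta>, of "?x D" "?x ?D"] x by (rule order.trans)
    moreover have "\<bar>L D \<xi> - L ?D \<xi>\<bar> \<le>
        norm ((?F D (?x D) - orc (?x D) \<xi>) - (?F ?D (?x ?D) - orc (?x ?D) \<xi>))"
      unfolding L_eq by (rule norm_triangle_ineq3)
    moreover have "(?F D (?x D) - orc (?x D) \<xi>) - (?F ?D (?x ?D) - orc (?x ?D) \<xi>) =
        ((?F D (?x D) - ?F D (?x ?D)) + (?F D (?x ?D) - ?F ?D (?x ?D))) - (orc (?x D) \<xi> - orc (?x ?D) \<xi>)"
      by simp
    moreover have "norm (((?F D (?x D) - ?F D (?x ?D)) + (?F D (?x ?D) - ?F ?D (?x ?D))) - (orc (?x D) \<xi> - orc (?x ?D) \<xi>))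
        \<le> norm (?F D (?x D) - ?F D (?x ?D)) + norm (?F D (?x ?D) - ?F ?D (?x ?D)) + norm (orc (?x D) \<xi> - orc (?x ?D) \<xi>)"
      by (intro order.trans[OF norm_triangle_ineq4] add_mono norm_triangle_ineq order.refl)
    ultimately show ?thesis by (simp add: \<beta>_def stab_beta_def)
  qed
  \<comment> \<open>The output's last component averages oracle values at the same point, so its
    distance to any one of them is at most the oscillation.\<close>
  have L_le: "L D \<xi> \<le> \<sigma>" if D: "D \<in> space Q" and \<xi>: "\<xi> \<in> \<Xi>" for D \<xi>
    using norm_mean_diff_le[OF N, of "\<lambda>i. orc (?x D) (D i)" "\<lambda>_. orc (?x D) \<xi>" \<sigma>] osc[OF DX[OF D] \<xi>] N
    by (simp add: L_eq emp_map_def sum_constant_scaleR del: sum_constant)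
  have z_meas[measurable]: "(\<lambda>D. out_z (out D)) \<in> borel_measurable Q"
    unfolding out_def out_z_dy_output Q_def using assms(14) \<theta> coc A B \<gamma> by (rule dy_iter_measurable)
  note [measurable] = borel_measurable_continuous_onI[OF resolvent_continuous_on[OF A \<gamma>]]
    borel_measurable_continuous_onI[OF resolvent_continuous_on[OF B \<gamma>]]
    borel_measurable_continuous_onI[OF cocoercive_continuous_on[OF assms(10) \<theta>]]
    emp_map_measurable[OF assms(14) \<theta> coc, of _ N, folded Q_def]
  have x_eq: "?x D = resolvent \<gamma> B (out_z (out D))" for D
    unfolding out_def out_x_dy_output out_z_dy_output ..
  have x_meas[measurable]: "?x \<in> borel_measurable Q" unfolding x_eq by measurable
  have orc_meas: "(\<lambda>\<omega>. orc (X \<omega>) (Y \<omega>)) \<in> borel_measurable M"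
    if "X \<in> borel_measurable M" "Y \<in> M \<rightarrow>\<^sub>M P" for X Y M
    using assms(14) cocoercive_continuous_on[OF coc \<theta>] that by (rule measurable_caratheodory)
  have L_meas: "(\<lambda>(D, \<xi>). L D \<xi>) \<in> borel_measurable (Q \<Otimes>\<^sub>M P)"
  proof -
    note [measurable] = orc_meas[of "\<lambda>p. ?x (fst p)" "Q \<Otimes>\<^sub>M P" snd]
    show ?thesis unfolding L_eq case_prod_unfold by measurable
  qed
  have Li_meas: "(\<lambda>D. L D (D i)) \<in> borel_measurable Q" if i: "i \<in> {1..N}" for i
  proof -
    have "(\<lambda>D. D i) \<in> Q \<rightarrow>\<^sub>M P" using i by (simp add: Q_def)
    note [measurable] = orc_meas[OF x_meas this]
    show ?thesis unfolding L_eq by measurable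
  qed
  define E where "E = (\<lambda>D. (\<Sum>i\<in>{1..N}. L D (D i)) / real N)"
  have emp_loss_eq: "emp_loss N orc D (out D) = E D" for D
    by (simp add: E_def emp_loss_def L_def)
  have E_meas[measurable]: "E \<in> borel_measurable Q"
    unfolding E_def using Li_meas by measurable
  define s where "s = sqrt (ln (1 / \<delta>) / (2 * real N))"
  have s: "s \<ge> 0" using assms(6,7) by (simp add: s_def)
  obtain D0 where D0: "D0 \<in> space Q" using Q.not_empty by auto
  have "\<beta> \<ge> 0"
    using stab[of 1 D0 "D0 1" "D0 1"] N DX[OF D0, of 1] D0 abs_ge_zero order_trans by fastforce
  \<comment> \<open>Here \<beta> already measures the replacement of a sample. The classical
    constants \<open>2 * \<beta>\<close> and \<open>4 * real N * \<beta>\<close> start from removal,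
    where a replacement counts twice; they are larger because
    \<open>\<beta> \<ge> 0\<close>.\<close>
  then have gap: "\<beta> + (2 * real N * \<beta> + \<sigma>) * s \<le> gen_gap \<sigma> N \<beta> \<delta>"
    using s N unfolding gen_gap_def s_def[symmetric] by (intro add_mono mult_right_mono) auto
  have "1 - \<delta> \<le> \<P>(D in Q. (\<integral>\<xi>. L D \<xi> \<partial>P) \<le> E D + \<beta> + (2 * real N * \<beta> + \<sigma>) * s)"
    using uniform_stability_generalization[of P "{1..N}" L \<sigma> \<beta> \<delta>, folded Q_def] N L_meas L_le stab assms(3,6,7,12,13)
    by (simp add: E_def s_def L_def loss_nonneg)
  \<comment> \<open>The residual estimate holds for every dataset in the first event, so an
    inclusion of events and measurability of the larger one suffice.\<close>
  also have "\<dots> \<le> \<P>(D in Q. dy_residual \<gamma> A B C (out_z (out D))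
        \<le> dy_residual \<gamma> A B (?F D) (out_z (out D)) + \<gamma> * (E D + gen_gap \<sigma> N \<beta> \<delta>))"
  proof (intro Q.finite_measure_mono)
    show "{D \<in> space Q. dy_residual \<gamma> A B C (out_z (out D))
        \<le> dy_residual \<gamma> A B (?F D) (out_z (out D)) + \<gamma> * (E D + gen_gap \<sigma> N \<beta> \<delta>)} \<in> sets Q"
      unfolding dy_residual_def dy_operator_def by measurable
    show "{D \<in> space Q. (\<integral>\<xi>. L D \<xi> \<partial>P) \<le> E D + \<beta> + (2 * real N * \<beta> + \<sigma>) * s} \<subseteq>
        {D \<in> space Q. dy_residual \<gamma> A B C (out_z (out D))
          \<le> dy_residual \<gamma> A B (?F D) (out_z (out D)) + \<gamma> * (E D + gen_gap \<sigma> N \<beta> \<delta>)}"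
    proof safe
      fix D assume D: "D \<in> space Q"
        and le: "(\<integral>\<xi>. L D \<xi> \<partial>P) \<le> E D + \<beta> + (2 * real N * \<beta> + \<sigma>) * s"
      have int: "integrable P (orc (?x D))" and C_eq: "C (?x D) = (\<integral>\<xi>. orc (?x D) \<xi> \<partial>P)"
        using assms(15)[of "?x D"] by (auto simp: has_bochner_integral_iff)
      \<comment> \<open>Jensen's inequality: since \<open>P\<close> has mass 1 and \<open>C\<close>
        is the mean of the oracle, the difference is an integral whose integrand has norm
        \<open>L D \<xi>\<close>.\<close>
      have "?F D (?x D) - C (?x D) = (\<integral>\<xi>. ?F D (?x D) - orc (?x D) \<xi> \<partial>P)"
        using int by (simp add: C_eq P.prob_space)
      also have "norm \<dots> \<le> (\<integral>\<xi>. L D \<xi> \<partial>P)" unfolding L_eq by (rule integral_norm_bound)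
      finally have "norm (?F D (?x D) - C (?x D)) \<le> E D + gen_gap \<sigma> N \<beta> \<delta>"
        using le gap by linarith
      from mult_left_mono[OF this, of \<gamma>] \<gamma>
      show "dy_residual \<gamma> A B C (out_z (out D))
          \<le> dy_residual \<gamma> A B (?F D) (out_z (out D)) + \<gamma> * (E D + gen_gap \<sigma> N \<beta> \<delta>)"
        using dy_residual_diff_le[OF A \<gamma>, of B C "out_z (out D)" "?F D"] unfolding x_eq by linarith
    qed
  qed
  finally show ?thesis
    by (simp only: emp_loss_eq[symmetric] out_def Q_def \<beta>_def \<eta>_def)
qed

end
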